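(* Let $f_A:\mathbb{T}^4\to\mathbb{T}^4$ be a partially hyperbolic symplectic automorphism, let $\hat O=p(0)$ be its fixed point, and let $W^u(\hat O)=p(l^u)$ be the one-dimensional unstable leaf passing through $\hat O$. Then the closure of $W^u(\hat O)$ in $\mathbb{T}^4$ is either a 2-dimensional torus or the whole $\mathbb{T}^4$ (that is, in the latter case the leaf is transitive, i.e. dense in $\mathbb{T}^4$).
   Context: Let $\mathbb{T}^4=\mathbb{R}^4/\mathbb{Z}^4$ and let $p:\mathbb{R}^4\to\mathbb{T}^4$ be the projection. An integer unimodular $4\times4$ matrix $A$ acts on $\mathbb{R}^4$ by $L_A:x\mapsto Ax$ and induces an automorphism $f_A$ of $\mathbb{T}^4$. The automorphism $f_A$ (or the matrix $A$) is called symplectic if $A^\top J A=J$ for a skew-symmetric unimodular integer matrix $J$ (the standard one, $J=\begin{pmatrix}0&E\\-E&0\end{pmatrix}$ with $E$ the $2\times2$ identity matrix, or a non-standard one). A symplectic $A$ is called partially hyperbolic if its eigenvalues are two real numbers $\lambda,\lambda^{-1}$ with $0<|\lambda|<1$ and a pair of complex conjugate non-real numbers $e^{\pm i\alpha}$ on the unit circle. The line $l^u\subset\mathbb{R}^4$ is the one-dimensional eigenspace of $A$ for the real eigenvalue of modulus greater than $1$. A "2-dimensional torus" in $\mathbb{T}^4$ here means a smoothly embedded 2-dimensional torus (a closed connected 2-dimensional subgroup of $\mathbb{T}^4$). *)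

theory Defs
  imports "HOL-Analysis.Analysis"
begin

definition lattice_rel :: "real^'n \<Rightarrow> real^'n \<Rightarrow> bool" where
  "lattice_rel x y \<longleftrightarrow> (\<forall>i. x $ i - y $ i \<in> \<int>)"

lemma equivp_lattice_rel: "equivp (lattice_rel :: real^'n \<Rightarrow> _)"
proof (rule equivpI)
  show "reflp (lattice_rel :: real^'n \<Rightarrow> _)"
    by (simp add: reflp_def lattice_rel_def)
  show "symp (lattice_rel :: real^'n \<Rightarrow> _)"
    unfolding symp_def lattice_rel_def by (metis Ints_minus minus_diff_eq)
  show "transp (lattice_rel :: real^'n \<Rightarrow> _)"
    unfolding transp_def lattice_rel_def by (metis Ints_add diff_add_cancel add_diff_eq)
qed

quotient_type 'n torus = "real^'n::finite" / lattice_rel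
  by (rule equivp_lattice_rel)

lift_definition torus_proj :: "real^'n::finite \<Rightarrow> 'n torus" is "\<lambda>x. x" .

lemma torus_proj_eq_iff: "torus_proj x = torus_proj y \<longleftrightarrow> (\<forall>i. x $ i - y $ i \<in> \<int>)"
  by transfer (simp add: lattice_rel_def)

lemma surj_torus_proj: "surj torus_proj"
  unfolding surj_def by transfer (metis equivp_lattice_rel equivp_reflp)

instantiation torus :: (finite) ab_group_add
begin

lift_definition zero_torus :: "'a torus" is 0 .

lift_definition plus_torus :: "'a torus \<Rightarrow> 'a torus \<Rightarrow> 'a torus" is "(+)"
  unfolding lattice_rel_def by (simp add: add_diff_add)

lift_definition uminus_torus :: "'a torus \<Rightarrow> 'a torus" is uminus
  unfolding lattice_rel_def by (metis Ints_minus minus_diff_minus vector_uminus_component)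

lift_definition minus_torus :: "'a torus \<Rightarrow> 'a torus \<Rightarrow> 'a torus" is "(-)"
proof -
  fix x x' y y' :: "real^'a"
  assume *: "lattice_rel x x'" "lattice_rel y y'"
  have "(x - y) $ i - (x' - y') $ i = (x $ i - x' $ i) - (y $ i - y' $ i)" for i
    by simp
  with * show "lattice_rel (x - y) (x' - y')"
    unfolding lattice_rel_def by (metis Ints_diff)
qed

instance
  by standard (transfer; simp add: lattice_rel_def algebra_simps)+

end

instantiation torus :: (finite) topological_space
begin

definition open_torus :: "'a torus set \<Rightarrow> bool" where
  "open_torus U \<longleftrightarrow> open (torus_proj -` U)"

instance
  by standard (auto simp: open_torus_def vimage_Union)

end

lemma continuous_on_torus_proj: "continuous_on S torus_proj"
  by (rule continuous_on_subset[OF _ subset_UNIV])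
    (simp add: continuous_on_open_vimage open_torus_def)

primrec C_k :: "nat \<Rightarrow> ('a::real_normed_vector \<Rightarrow> 'b::real_normed_vector) \<Rightarrow> bool" where
  "C_k 0 g \<longleftrightarrow> continuous_on UNIV g"
| "C_k (Suc k) g \<longleftrightarrow> (\<forall>x. g differentiable (at x)) \<and>
     (\<forall>v. C_k k (\<lambda>x. frechet_derivative g (at x) v))"

definition smooth :: "('a::real_normed_vector \<Rightarrow> 'b::real_normed_vector) \<Rightarrow> bool" where
  "smooth g \<longleftrightarrow> (\<forall>k. C_k k g)"

text \<open>
  Since \<^const>\<open>torus_proj\<close> is a smooth covering by a simply connected space, a map between
  tori is smooth iff it has a smooth lift to the covering spaces; its differential is that
  of the lift.
\<close>

definition smooth_torus_embedding :: "('m::finite torus \<Rightarrow> 'n::finite torus) \<Rightarrow> bool" where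
  "smooth_torus_embedding F \<longleftrightarrow>
     (\<exists>g :: real^'m \<Rightarrow> real^'n. smooth g \<and> (\<forall>x. F (torus_proj x) = torus_proj (g x)) \<and>
        (\<forall>x. inj (frechet_derivative g (at x)))) \<and>
     (\<exists>G. homeomorphism UNIV (range F) F G)"

definition torus_subgroup :: "'n::finite torus set \<Rightarrow> bool" where
  "torus_subgroup S \<longleftrightarrow> 0 \<in> S \<and> (\<forall>x\<in>S. \<forall>y\<in>S. x + y \<in> S) \<and> (\<forall>x\<in>S. - x \<in> S)"

text \<open>The dimension of the subgroup is fixed by the embedding of the 2-torus.\<close>

definition two_dim_torus :: "'n::finite torus set \<Rightarrow> bool" where
  "two_dim_torus S \<longleftrightarrow> closed S \<and> connected S \<and> torus_subgroup S \<and>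
     (\<exists>F :: 2 torus \<Rightarrow> 'n torus. smooth_torus_embedding F \<and> range F = S)"

definition unimodular :: "int^'n^'n \<Rightarrow> bool" where
  "unimodular A \<longleftrightarrow> \<bar>det A\<bar> = 1"

definition real_matrix :: "int^'n^'m \<Rightarrow> real^'n^'m" where
  "real_matrix A = map_matrix of_int A"

definition complex_matrix :: "int^'n^'m \<Rightarrow> complex^'n^'m" where
  "complex_matrix A = map_matrix of_int A"

lift_definition torus_map :: "int^'n^'n \<Rightarrow> 'n::finite torus \<Rightarrow> 'n torus" is
  "\<lambda>A x. real_matrix A *v x"
proof -
  fix A :: "int^'n^'n" and x y :: "real^'n"
  assume "lattice_rel x y"
  then have "(\<Sum>j\<in>UNIV. real_of_int (A $ i $ j) * (x $ j - y $ j)) \<in> \<int>" for i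
    unfolding lattice_rel_def by (intro Ints_sum Ints_mult) auto
  then show "lattice_rel (real_matrix A *v x) (real_matrix A *v y)"
    by (simp add: lattice_rel_def real_matrix_def matrix_vector_mult_def
        right_diff_distrib sum_subtractf)
qed

lemma torus_map_proj: "torus_map A (torus_proj x) = torus_proj (real_matrix A *v x)"
  by transfer (simp add: lattice_rel_def)

lemma torus_map_fixes_origin: "torus_map A (torus_proj 0) = torus_proj 0"
  by (simp add: torus_map_proj)

definition symplectic :: "int^'n^'n \<Rightarrow> bool" where
  "symplectic A \<longleftrightarrow>
     (\<exists>J :: int^'n^'n. transpose J = - J \<and> unimodular J \<and> transpose A ** J ** A = J)"

definition eigenvalues :: "int^'n^'n \<Rightarrow> complex set" where
  "eigenvalues A = {\<mu>. \<exists>v. v \<noteq> 0 \<and> complex_matrix A *v v = \<mu> *s v}"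

text \<open>
  For a 4 by 4 matrix the four listed eigenvalues are pairwise distinct, hence all simple.
\<close>

definition partially_hyperbolic :: "int^4^4 \<Rightarrow> bool" where
  "partially_hyperbolic A \<longleftrightarrow>
     (\<exists>l \<alpha> :: real. 0 < \<bar>l\<bar> \<and> \<bar>l\<bar> < 1 \<and> cis \<alpha> \<notin> \<real> \<and>
        eigenvalues A = {of_real l, of_real (inverse l), cis \<alpha>, cis (- \<alpha>)})"

definition unstable_eigenvalue :: "int^'n^'n \<Rightarrow> real" where
  "unstable_eigenvalue A = (THE \<mu>. 1 < \<bar>\<mu>\<bar> \<and> complex_of_real \<mu> \<in> eigenvalues A)"

definition unstable_line :: "int^'n^'n \<Rightarrow> (real^'n) set" where
  "unstable_line A = {v. real_matrix A *v v = unstable_eigenvalue A *\<^sub>R v}"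

definition unstable_leaf :: "int^'n^'n \<Rightarrow> 'n::finite torus set" where
  "unstable_leaf A = torus_proj ` unstable_line A"

end

theory Submission
  imports Defs "HOL-Analysis.Kronecker_Approximation_Theorem"
begin

text \<open>
  Let \<open>v\<close> span the unstable line, let \<open>w\<close> be a stable eigenvector for the eigenvalue \<open>l\<close>, and call the
  plane of \<open>v\<close> and \<open>w\<close> the hyperbolic plane. The dichotomy is whether some nonzero integer vector \<open>k\<close>
  is orthogonal to \<open>v\<close>.

  If there is none, the coordinates of \<open>v\<close> are independent over the integers, and Kronecker's theorem
  makes the leaf dense in the whole torus (\<open>dense_line_in_torus\<close>).

  If there is such a \<open>k\<close>, its orbit under the transpose of \<open>A\<close> avoids the expanding direction and is
  therefore bounded; being integral it repeats, which forces \<open>k\<close> to be orthogonal to \<open>w\<close> as well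
  (\<open>resonance_stable\<close>). So \<open>k\<close> is annihilated by the transpose of \<open>A\<^sup>2 - (2 cos \<alpha>) A + 1\<close>, and comparing
  integer coordinates shows that \<open>2 cos \<alpha>\<close> is rational (\<open>resonance_rational_trace\<close>). The operator
  \<open>A\<^sup>2 - (2 cos \<alpha>) A + 1\<close> maps onto the hyperbolic plane, and a multiple of it is now an integer matrix,
  so the plane contains nonzero integer points (\<open>integral_hyperbolic_point\<close>). One of them and its image under
  \<open>A\<close> are independent, hence the integer points of the plane form a lattice of rank two, and the
  plane covers a smoothly embedded 2-torus that is a closed subgroup (\<open>exists_integral_plane_basis\<close>,
  \<open>two_dim_torus_plane\<close>).

  The leaf is dense in that 2-torus. By Kronecker's theorem in dimension two this can only fail if a
  nonzero multiple of \<open>v\<close> is an integer vector; but the integer area spanned by such a multiple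
  and the \<open>n\<close>-th image of an integer point off the unstable line is proportional to \<open>l ^ n\<close>, a
  nonzero sequence tending to zero (\<open>unstable_not_integral\<close>).
\<close>

section \<open>The integer lattice and the topology of the torus\<close>

definition int_lattice :: "(real^'n) set" where
  "int_lattice = {x. \<forall>i. x $ i \<in> \<int>}"

lemma int_latticeD: "x \<in> int_lattice \<Longrightarrow> x $ i \<in> \<int>"
  by (simp add: int_lattice_def)

lemma zero_in_int_lattice: "0 \<in> int_lattice"
  by (simp add: int_lattice_def)

lemma int_lattice_add: "x \<in> int_lattice \<Longrightarrow> y \<in> int_lattice \<Longrightarrow> x + y \<in> int_lattice"
  by (simp add: int_lattice_def)

lemma int_lattice_diff: "x \<in> int_lattice \<Longrightarrow> y \<in> int_lattice \<Longrightarrow> x - y \<in> int_lattice"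
  by (simp add: int_lattice_def)

lemma int_lattice_scaleR: "r \<in> \<int> \<Longrightarrow> x \<in> int_lattice \<Longrightarrow> r *\<^sub>R x \<in> int_lattice"
  by (simp add: int_lattice_def)

lemma axis_in_int_lattice: "axis i 1 \<in> int_lattice"
  by (simp add: int_lattice_def axis_def)

lemma finite_bounded_int_lattice:
  "finite {x \<in> int_lattice :: (real^'n::finite) set. \<forall>i. \<bar>x $ i\<bar> \<le> R}"
proof (rule finite_subset)
  let ?S = "{k \<in> \<int>. \<bar>k\<bar> \<le> R}"
  show "{x \<in> int_lattice :: (real^'n) set. \<forall>i. \<bar>x $ i\<bar> \<le> R} \<subseteq> vec_lambda ` (UNIV \<rightarrow>\<^sub>E ?S)"
  proof
    fix x :: "real^'n" assume "x \<in> {x \<in> int_lattice. \<forall>i. \<bar>x $ i\<bar> \<le> R}"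
    then have "vec_nth x \<in> UNIV \<rightarrow>\<^sub>E ?S"
      by (auto simp: int_lattice_def)
    moreover have "x = vec_lambda (vec_nth x)"
      by simp
    ultimately show "x \<in> vec_lambda ` (UNIV \<rightarrow>\<^sub>E ?S)"
      by blast
  qed
  show "finite (vec_lambda ` (UNIV \<rightarrow>\<^sub>E ?S) :: (real^'n) set)"
    by (intro finite_imageI finite_PiE) (auto simp: finite_abs_int_segment)
qed

lemma torus_proj_eq_iff_lattice: "torus_proj x = torus_proj y \<longleftrightarrow> x - y \<in> int_lattice"
  by (simp add: torus_proj_eq_iff int_lattice_def)

lemma torus_proj_zero: "torus_proj 0 = 0"
  by transfer (simp add: lattice_rel_def)

lemma torus_proj_add: "torus_proj (x + y) = torus_proj x + torus_proj y"
  by transfer (simp add: lattice_rel_def)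

lemma torus_proj_minus: "torus_proj (- x) = - torus_proj x"
  by transfer (simp add: lattice_rel_def)

lemma torus_proj_exhaust: obtains x where "z = torus_proj x"
  using surj_torus_proj by (metis surjD)

lemma cis_2pi_eq_iff: "cis (2 * pi * x) = cis (2 * pi * y) \<longleftrightarrow> x - y \<in> \<int>"
proof -
  have "cis (2 * pi * x) = cis (2 * pi * y) \<longleftrightarrow> cis (2 * pi * (x - y)) = 1"
    by (simp add: right_diff_distrib flip: cis_divide)
  also have "\<dots> \<longleftrightarrow> (\<exists>n::int. x - y = of_int n)"
    by (auto simp: cis_conv_exp exp_eq_1 simp flip: right_diff_distrib)
  also have "\<dots> \<longleftrightarrow> x - y \<in> \<int>"
    by (auto elim: Ints_cases)
  finally show ?thesis .
qed

text \<open>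
  The characters \<open>x \<mapsto> exp (2 \<pi> \<i> x\<^sub>i)\<close> are continuous on the torus and separate its points, so
  disjoint open sets of complex numbers pull back to disjoint open sets of the torus. With
  compactness, this makes every continuous injection of one torus into another a homeomorphism
  onto a closed image.
\<close>

instance torus :: (finite) t2_space
proof
  fix p q :: "'a torus"
  assume "p \<noteq> q"
  obtain x y where p: "p = torus_proj x" and q: "q = torus_proj y"
    by (metis torus_proj_exhaust)
  with \<open>p \<noteq> q\<close> obtain i where i: "x $ i - y $ i \<notin> \<int>"
    by (auto simp: torus_proj_eq_iff)
  define ch where "ch = (\<lambda>z :: real^'a. cis (2 * pi * z $ i))"
  have invariant: "ch z = ch z'" if "torus_proj z = torus_proj z'" for z z'
    using that by (simp add: ch_def cis_2pi_eq_iff torus_proj_eq_iff)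
  have "continuous_on UNIV ch"
    unfolding ch_def by (intro continuous_intros)
  then have open_pullback: "open (torus_proj ` (ch -` U))" if "open U" for U
  proof -
    have "torus_proj -` torus_proj ` (ch -` U) = ch -` U"
      by (safe; metis invariant vimageE vimageI imageE imageI)
    then show ?thesis
      using \<open>continuous_on UNIV ch\<close> that by (simp add: open_torus_def open_vimage)
  qed
  have "ch x \<noteq> ch y"
    using i by (simp add: ch_def cis_2pi_eq_iff)
  then obtain U W where UW: "open U" "open W" "ch x \<in> U" "ch y \<in> W" "U \<inter> W = {}"
    by (metis hausdorff)
  show "\<exists>U V. open U \<and> open V \<and> p \<in> U \<and> q \<in> V \<and> U \<inter> V = {}"
  proof (intro exI conjI)
    show "torus_proj ` (ch -` U) \<inter> torus_proj ` (ch -` W) = {}"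
      using UW(5) by (safe; metis invariant IntI empty_iff vimageE)
  qed (use UW p q open_pullback in auto)
qed

lemma compact_torus: "compact (UNIV :: 'n::finite torus set)"
proof -
  have "(UNIV :: 'n torus set) \<subseteq> torus_proj ` cbox 0 1"
  proof
    fix z :: "'n torus"
    obtain x where z: "z = torus_proj x"
      by (rule torus_proj_exhaust)
    have "z = torus_proj (\<chi> i. frac (x $ i))"
      by (simp add: z torus_proj_eq_iff frac_def)
    moreover have "(\<chi> i. frac (x $ i)) \<in> cbox 0 (1 :: real^'n)"
      by (simp add: mem_box_cart frac_lt_1 less_imp_le)
    ultimately show "z \<in> torus_proj ` cbox 0 1"
      by blast
  qed
  then have "(UNIV :: 'n torus set) = torus_proj ` cbox 0 1"
    by blast
  then show ?thesis
    using compact_continuous_image[OF continuous_on_torus_proj compact_cbox] by metis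
qed

section \<open>Dense one-parameter subgroups\<close>

text \<open>
  Kronecker's theorem on simultaneous approximation speaks of a family of real numbers that are
  independent over the integers. For the coordinates of a vector \<open>y\<close> this independence says that
  no nonzero integer vector is orthogonal to \<open>y\<close>; the proof only transports indices.
\<close>

lemma Kronecker_approximation_vector:
  fixes y a :: "real^'n::finite"
  assumes indep: "\<And>k. k \<in> int_lattice \<Longrightarrow> k \<bullet> y = 0 \<Longrightarrow> k = 0" and "\<epsilon> > 0"
  obtains t h where "h \<in> int_lattice" "\<And>i. \<bar>(t *\<^sub>R y - h - a) $ i\<bar> < \<epsilon>"
proof -
  interpret Z: Modules.module "(\<lambda>r. (*) (real_of_int r))"
    by (simp add: Modules.module.intro distrib_left mult.commute)
  obtain f where f: "bij_betw f {..<CARD('n)} (UNIV :: 'n set)"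
    using ex_bij_betw_nat_finite[of "UNIV :: 'n set"] by (auto simp: atLeast0LessThan)
  have inj_y: "inj (vec_nth y)"
  proof (rule injI, rule ccontr)
    fix i j assume "y $ i = y $ j" "i \<noteq> j"
    then have "axis i 1 - axis j 1 = (0 :: real^'n)"
      by (intro indep) (auto simp: int_lattice_diff axis_in_int_lattice inner_diff_left inner_axis')
    with \<open>i \<noteq> j\<close> show False
      by (metis axis_eq_axis eq_iff_diff_eq_0 zero_neq_one)
  qed
  have "Z.independent (range (vec_nth y))"
    unfolding Z.dependent_explicit
  proof clarify
    fix T u \<theta>
    assume T: "finite T" "T \<subseteq> range (vec_nth y)" "(\<Sum>r\<in>T. real_of_int (u r) * r) = 0"
      and \<theta>: "\<theta> \<in> T" "u \<theta> \<noteq> 0"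
    define k :: "real^'n" where "k = (\<chi> i. if y $ i \<in> T then u (y $ i) else 0)"
    have "k \<bullet> y = (\<Sum>i\<in>vec_nth y -` T. of_int (u (y $ i)) * y $ i)"
      unfolding inner_vec_def k_def by (intro sum.mono_neutral_cong_right) auto
    also have "\<dots> = (\<Sum>r\<in>vec_nth y ` (vec_nth y -` T). of_int (u r) * r)"
      by (subst sum.reindex) (use inj_y in \<open>auto simp: inj_on_def\<close>)
    also have "vec_nth y ` (vec_nth y -` T) = T"
      using T(2) by auto
    finally have "k \<bullet> y = 0"
      using T(3) by simp
    moreover have "k \<in> int_lattice"
      by (simp add: k_def int_lattice_def)
    ultimately have "k = 0"
      by (rule indep[rotated])
    moreover obtain i where "y $ i = \<theta>"
      using T(2) \<theta>(1) by auto
    moreover from this have "k $ i = of_int (u \<theta>)"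
      using \<theta>(1) by (simp add: k_def)
    ultimately show False
      using \<theta>(2) by simp
  qed
  moreover have "(\<lambda>i. y $ f i) ` {..<CARD('n)} = range (vec_nth y)"
    using f by (metis bij_betw_imp_surj_on image_image)
  moreover have "inj_on (\<lambda>i. y $ f i) {..<CARD('n)}"
    using f inj_y by (auto simp: bij_betw_def inj_on_def)
  ultimately have "Z.independent ((\<lambda>i. y $ f i) ` {..<CARD('n)})" "inj_on (\<lambda>i. y $ f i) {..<CARD('n)}"
    by simp_all
  then obtain t h where th:
      "\<And>i. i < CARD('n) \<Longrightarrow> \<bar>t * y $ f i - of_int (h i) - a $ f i\<bar> < \<epsilon>"
    by (rule Kronecker_thm_1[OF _ _ \<open>\<epsilon> > 0\<close>, of "\<lambda>i. y $ f i" _ "\<lambda>i. a $ f i"]) blast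
  define g where "g = inv_into {..<CARD('n)} f"
  have g: "g i < CARD('n)" "f (g i) = i" for i
    using f inv_into_into[of i f "{..<CARD('n)}"] f_inv_into_f[of i f "{..<CARD('n)}"]
    by (auto simp: g_def bij_betw_def)
  show ?thesis
  proof
    show "(\<chi> i. of_int (h (g i))) \<in> int_lattice"
      by (simp add: int_lattice_def)
    show "\<bar>(t *\<^sub>R y - (\<chi> i. of_int (h (g i))) - a) $ i\<bar> < \<epsilon>" for i
      using th[OF g(1)[of i]] by (simp add: g(2))
  qed
qed

text \<open>
  Kronecker approximation moves a point of the line by an integer vector, which the torus does not
  see, to within any prescribed distance of an arbitrary point.
\<close>

lemma dense_line_in_torus:
  fixes y :: "real^'n::finite"
  assumes "\<And>k. k \<in> int_lattice \<Longrightarrow> k \<bullet> y = 0 \<Longrightarrow> k = 0"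
  shows "closure (torus_proj ` range (\<lambda>t. t *\<^sub>R y)) = UNIV"
proof -
  have "\<exists>t. torus_proj (t *\<^sub>R y) \<in> U" if U: "open U" "z \<in> U" for U and z :: "'n torus"
  proof -
    obtain x where z: "z = torus_proj x"
      by (rule torus_proj_exhaust)
    \<comment> \<open>Coordinatewise errors below \<open>e / n\<close> add up to a norm below \<open>e\<close>.\<close>
    have "open (torus_proj -` U)" "x \<in> torus_proj -` U"
      using U z by (auto simp: open_torus_def)
    then obtain e where e: "e > 0" "ball x e \<subseteq> torus_proj -` U"
      by (meson openE)
    define \<epsilon> where "\<epsilon> = e / CARD('n)"
    have "\<epsilon> > 0"
      using e by (simp add: \<epsilon>_def)
    then obtain t h where h: "h \<in> int_lattice" and "\<And>i. \<bar>(t *\<^sub>R y - h - x) $ i\<bar> < \<epsilon>"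
      using Kronecker_approximation_vector[of y \<epsilon> x] assms by metis
    then have "(\<Sum>i\<in>UNIV. \<bar>(t *\<^sub>R y - h - x) $ i\<bar>) < (\<Sum>i\<in>(UNIV::'n set). \<epsilon>)"
      by (intro sum_strict_mono) auto
    then have "norm (t *\<^sub>R y - h - x) < e"
      using norm_le_l1_cart[of "t *\<^sub>R y - h - x"] by (simp add: \<epsilon>_def)
    then have "torus_proj (t *\<^sub>R y - h) \<in> U"
      using e(2) by (auto simp: dist_norm norm_minus_commute subset_iff)
    moreover have "torus_proj (t *\<^sub>R y) = torus_proj (t *\<^sub>R y - h)"
      using h by (simp add: torus_proj_eq_iff_lattice)
    ultimately show ?thesis
      by metis
  qed
  then show ?thesis
    unfolding closure_iff_nhds_not_empty set_eq_iff by blast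
qed

section \<open>Rational planes and the tori that they cover\<close>

text \<open>
  The coordinate minors of two vectors measure oriented area inside the plane that they span. They
  are integers on integer vectors, and both uses below rest on this: an area that is minimal
  exists, and an area that shrinks to zero along an orbit vanishes.
\<close>

definition minor2 :: "'n \<Rightarrow> 'n \<Rightarrow> real^'n \<Rightarrow> real^'n \<Rightarrow> real" where
  "minor2 i j p q = p $ i * q $ j - p $ j * q $ i"

lemma minor2_combination:
  "minor2 i j (r *\<^sub>R p + s *\<^sub>R q) (t *\<^sub>R p + u *\<^sub>R q) = (r * u - s * t) * minor2 i j p q"
  by (simp add: minor2_def algebra_simps)

lemma minor2_in_Ints: "p \<in> int_lattice \<Longrightarrow> q \<in> int_lattice \<Longrightarrow> minor2 i j p q \<in> \<int>"
  by (simp add: minor2_def int_lattice_def)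

lemma exists_nonzero_minor2:
  assumes "v \<noteq> 0" and "\<And>\<rho>. w \<noteq> \<rho> *\<^sub>R v"
  obtains i j where "minor2 i j v w \<noteq> 0"
proof (rule ccontr)
  assume "\<not> thesis"
  then have vanish: "minor2 i j v w = 0" for i j
    using that by blast
  obtain j where "v $ j \<noteq> 0"
    using \<open>v \<noteq> 0\<close> by (auto simp: vec_eq_iff)
  then have "w = (w $ j / v $ j) *\<^sub>R v"
    using vanish[of _ j] by (auto simp: vec_eq_iff minor2_def field_simps)
  with assms(2) show False
    by blast
qed

definition plane_map :: "real^'n \<Rightarrow> real^'n \<Rightarrow> real^2 \<Rightarrow> real^'n" where
  "plane_map p q x = x $ 1 *\<^sub>R p + x $ 2 *\<^sub>R q"

lemma linear_plane_map: "linear (plane_map p q)"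
  by (auto simp: linear_iff plane_map_def algebra_simps)

lemmas plane_map_simps =
  linear_add[OF linear_plane_map] linear_diff[OF linear_plane_map]
  linear_scale[OF linear_plane_map] linear_0[OF linear_plane_map] linear_neg[OF linear_plane_map]

lemma plane_map_vector: "plane_map p q (vector [r, s]) = r *\<^sub>R p + s *\<^sub>R q"
  by (simp add: plane_map_def)

lemma int_lattice_2_iff: "(x :: real^2) \<in> int_lattice \<longleftrightarrow> x $ 1 \<in> \<int> \<and> x $ 2 \<in> \<int>"
  by (simp add: int_lattice_def forall_2)

text \<open>
  The image of the plane map meets the integer lattice exactly in the integer combinations of \<open>p\<close>
  and \<open>q\<close>. This one equivalence contains that \<open>p\<close> and \<open>q\<close> are integer vectors and also that they
  are linearly independent.
\<close>

definition integral_plane_basis :: "real^'n \<Rightarrow> real^'n \<Rightarrow> bool" where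
  "integral_plane_basis p q \<longleftrightarrow> (\<forall>x. plane_map p q x \<in> int_lattice \<longleftrightarrow> x \<in> int_lattice)"

text \<open>
  A nonzero vector in the kernel could be rescaled so that one of its coordinates is \<open>1 / 2\<close>, and
  the rescaled vector would still be mapped to the integer vector \<open>0\<close>.
\<close>

lemma integral_plane_basis_eq_0:
  assumes basis: "integral_plane_basis p q" and zero: "plane_map p q x = 0"
  shows "x = 0"
proof (rule ccontr)
  assume "x \<noteq> 0"
  then obtain i where "x $ i \<noteq> 0"
    by (auto simp: vec_eq_iff)
  let ?y = "(1 / (2 * x $ i)) *\<^sub>R x"
  have "plane_map p q ?y = 0"
    using zero by (simp add: plane_map_simps)
  then have "?y \<in> int_lattice"
    using basis by (metis integral_plane_basis_def zero_in_int_lattice)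
  then have "?y $ i \<in> \<int>"
    by (rule int_latticeD)
  moreover have "?y $ i = 1 / 2"
    using \<open>x $ i \<noteq> 0\<close> by simp
  ultimately obtain n :: int where "of_int (2 * n) = (1 :: real)"
    by (auto elim!: Ints_cases simp: mult.commute[of 2] split: if_splits)
  then show False
    unfolding of_int_eq_1_iff by presburger
qed

text \<open>
  Two independent integer vectors in a plane need not generate all its integer points. A pair of
  least nonzero area does: if an integer point had a fractional coordinate, then replacing one
  vector of the pair by the fractional part of the point would multiply the area by a factor
  strictly between \<open>0\<close> and \<open>1\<close>.
\<close>

lemma exists_integral_plane_basis:
  fixes p\<^sub>0 q\<^sub>0 :: "real^'n::finite"
  assumes int: "p\<^sub>0 \<in> int_lattice" "q\<^sub>0 \<in> int_lattice" and nonzero: "minor2 i j p\<^sub>0 q\<^sub>0 \<noteq> 0"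
  obtains p q where "integral_plane_basis p q" "p\<^sub>0 \<in> range (plane_map p q)" "q\<^sub>0 \<in> range (plane_map p q)"
proof -
  define S where "S = {(p, q). p \<in> int_lattice \<inter> range (plane_map p\<^sub>0 q\<^sub>0) \<and>
      q \<in> int_lattice \<inter> range (plane_map p\<^sub>0 q\<^sub>0) \<and> minor2 i j p q \<noteq> 0}"
  define size where "size = (\<lambda>(p, q). nat \<lfloor>\<bar>minor2 i j p q\<bar>\<rfloor>)"
  have "p\<^sub>0 = plane_map p\<^sub>0 q\<^sub>0 (vector [1, 0])" "q\<^sub>0 = plane_map p\<^sub>0 q\<^sub>0 (vector [0, 1])"
    by (simp_all add: plane_map_vector)
  then have "(p\<^sub>0, q\<^sub>0) \<in> S"
    using int nonzero by (auto simp: S_def)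
  then obtain p q where pq: "(p, q) \<in> S" and minimal: "\<And>z. z \<in> S \<Longrightarrow> size (p, q) \<le> size z"
    using ex_has_least_nat[of "\<lambda>z. z \<in> S" "(p\<^sub>0, q\<^sub>0)" size] by auto
  let ?d = "minor2 i j"
  have int_pq: "p \<in> int_lattice" "q \<in> int_lattice" and d: "?d p q \<noteq> 0"
    using pq by (auto simp: S_def)
  obtain x y where xy: "p = plane_map p\<^sub>0 q\<^sub>0 x" "q = plane_map p\<^sub>0 q\<^sub>0 y"
    using pq by (auto simp: S_def)
  have in_plane: "plane_map p q z \<in> range (plane_map p\<^sub>0 q\<^sub>0)" for z
    unfolding plane_map_def[of p q] by (auto simp: xy simp flip: plane_map_simps)
  have not_smaller: "\<not> \<bar>?d p' q'\<bar> < \<bar>?d p q\<bar>" if "(p', q') \<in> S" for p' q'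
  proof -
    have "?d p' q' \<in> \<int>" "?d p q \<in> \<int>"
      using that pq by (auto simp: S_def intro: minor2_in_Ints)
    then show ?thesis
      using minimal[OF that] by (auto elim!: Ints_cases simp: size_def simp flip: of_int_abs)
  qed
  have integral: "x \<in> int_lattice" if x: "plane_map p q x \<in> int_lattice" for x
  proof -
    define z where "z = frac (x $ 1) *\<^sub>R p + frac (x $ 2) *\<^sub>R q"
    have "z = plane_map p q x - (of_int \<lfloor>x $ 1\<rfloor> *\<^sub>R p + of_int \<lfloor>x $ 2\<rfloor> *\<^sub>R q)"
      by (simp add: z_def plane_map_def frac_def algebra_simps)
    then have z_int: "z \<in> int_lattice"
      using x int_pq by (auto intro!: int_lattice_diff int_lattice_add int_lattice_scaleR)
    have z_plane: "z \<in> range (plane_map p\<^sub>0 q\<^sub>0)"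
      using in_plane[of "vector [frac (x $ 1), frac (x $ 2)]"] by (simp add: plane_map_vector z_def)
    have minors: "?d z q = frac (x $ 1) * ?d p q" "?d p z = frac (x $ 2) * ?d p q"
      by (simp_all add: z_def minor2_def algebra_simps)
    have small: "\<bar>frac t * ?d p q\<bar> < \<bar>?d p q\<bar>" for t
      using d by (simp add: abs_mult frac_lt_1)
    have "?d z q = 0"
      using not_smaller[of z q] small[of "x $ 1"] z_int z_plane pq by (auto simp: S_def minors)
    moreover have "?d p z = 0"
      using not_smaller[of p z] small[of "x $ 2"] z_int z_plane pq by (auto simp: S_def minors)
    ultimately show ?thesis
      using d by (simp add: minors int_lattice_2_iff)
  qed
  have "plane_map p q x \<in> int_lattice" if "x \<in> int_lattice" for x
    using that int_pq
    by (auto simp: plane_map_def int_lattice_2_iff intro!: int_lattice_add int_lattice_scaleR)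
  with integral have basis: "integral_plane_basis p q"
    by (auto simp: integral_plane_basis_def)
  define \<Delta> where "\<Delta> = x $ 1 * y $ 2 - x $ 2 * y $ 1"
  have "?d p q = \<Delta> * ?d p\<^sub>0 q\<^sub>0"
    unfolding xy plane_map_def \<Delta>_def by (rule minor2_combination)
  then have "\<Delta> \<noteq> 0"
    using d by auto
  \<comment> \<open>Cramer's rule recovers the original vectors from the new pair.\<close>
  have "\<Delta> *\<^sub>R p\<^sub>0 = y $ 2 *\<^sub>R p - x $ 2 *\<^sub>R q" "\<Delta> *\<^sub>R q\<^sub>0 = x $ 1 *\<^sub>R q - y $ 1 *\<^sub>R p"
    by (simp_all add: xy plane_map_def \<Delta>_def algebra_simps)
  then have "p\<^sub>0 = (1 / \<Delta>) *\<^sub>R (y $ 2 *\<^sub>R p - x $ 2 *\<^sub>R q)" "q\<^sub>0 = (1 / \<Delta>) *\<^sub>R (x $ 1 *\<^sub>R q - y $ 1 *\<^sub>R p)"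
    using \<open>\<Delta> \<noteq> 0\<close> by (metis divide_self one_neq_zero scaleR_one scaleR_scaleR times_divide_eq_left mult_1)+
  then have "p\<^sub>0 = plane_map p q (vector [y $ 2 / \<Delta>, - x $ 2 / \<Delta>])"
      "q\<^sub>0 = plane_map p q (vector [- y $ 1 / \<Delta>, x $ 1 / \<Delta>])"
    by (simp_all add: plane_map_vector scaleR_diff_right)
  then show thesis
    using that basis by blast
qed

text \<open>
  The derivative of a linear map in a fixed direction does not depend on the base point, so all
  derivatives from the second on are zero.
\<close>

lemma smooth_linear:
  fixes g :: "'a::euclidean_space \<Rightarrow> 'b::real_normed_vector"
  assumes "linear g"
  shows "smooth g"
proof -
  have const: "C_k k (\<lambda>_ :: 'a. c :: 'b)" for k c
    by (induction k arbitrary: c) (simp_all add: frechet_derivative_const)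
  have "bounded_linear g"
    using assms by (simp add: linear_conv_bounded_linear)
  then have "(g has_derivative g) (at x)" for x
    by (rule bounded_linear_imp_has_derivative)
  then have "g differentiable at x" "frechet_derivative g (at x) = g" for x
    by (metis differentiable_def, metis frechet_derivative_at)
  then have "C_k k g" for k
    using \<open>bounded_linear g\<close> by (cases k) (auto simp: const linear_continuous_on)
  then show ?thesis
    by (simp add: smooth_def)
qed

text \<open>
  The equivalence in the definition of an integral basis says both that the plane map descends to
  the 2-torus and that the induced map is injective; compactness of the 2-torus then gives a
  topological embedding.
\<close>

lemma plane_map_torus_descends:
  assumes "integral_plane_basis p q"
  obtains F where "\<And>x. F (torus_proj x) = torus_proj (plane_map p q x)"
    "continuous_on UNIV F" "smooth_torus_embedding F"
proof -
  have "torus_proj x = torus_proj y \<longleftrightarrow> torus_proj (plane_map p q x) = torus_proj (plane_map p q y)" for x y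
    using assms by (simp add: torus_proj_eq_iff_lattice integral_plane_basis_def flip: plane_map_simps)
  note descends = this
  then obtain F where F: "F (torus_proj x) = torus_proj (plane_map p q x)" for x
    using function_factors_left[of torus_proj "\<lambda>x. torus_proj (plane_map p q x)"]
    by (auto simp: fun_eq_iff)
  have "inj F"
    by (rule injI) (metis F descends torus_proj_exhaust)
  have "continuous_on UNIV F"
  proof (simp add: continuous_on_open_vimage, safe)
    fix U :: "'a torus set" assume "open U"
    have "torus_proj -` F -` U = plane_map p q -` torus_proj -` U"
      by (auto simp: F)
    moreover have "continuous_on UNIV (plane_map p q)"
      by (simp add: linear_plane_map linear_continuous_on linear_conv_bounded_linear[symmetric])
    ultimately show "open (F -` U)"
      using \<open>open U\<close> by (simp add: open_torus_def open_vimage)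
  qed
  have "\<exists>G. homeomorphism UNIV (range F) F G"
    using compact_torus \<open>continuous_on UNIV F\<close> \<open>inj F\<close> by (intro homeomorphism_compact) auto
  moreover have "frechet_derivative (plane_map p q) (at x) = plane_map p q" for x
    by (metis linear_plane_map frechet_derivative_at linear_imp_has_derivative)
  moreover have "inj (plane_map p q)"
    using integral_plane_basis_eq_0[OF assms] by (metis linear_plane_map linear_injective_0)
  ultimately have "smooth_torus_embedding F"
    unfolding smooth_torus_embedding_def using F smooth_linear[OF linear_plane_map]
    by metis
  then show thesis
    using that F \<open>continuous_on UNIV F\<close> by blast
qed

lemma two_dim_torus_plane:
  assumes "integral_plane_basis p q"
  shows "two_dim_torus (torus_proj ` range (plane_map p q))"
proof -
  obtain F where F: "\<And>x. F (torus_proj x) = torus_proj (plane_map p q x)"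
      "continuous_on UNIV F" "smooth_torus_embedding F"
    using plane_map_torus_descends[OF assms] by metis
  let ?T = "torus_proj ` range (plane_map p q)"
  have "range F = F ` range torus_proj"
    by (simp add: surj_torus_proj)
  then have range: "range F = ?T"
    by (simp add: image_image F(1))
  have "compact ?T"
    using F(2) compact_torus range compact_continuous_image by metis
  then have "closed ?T"
    by (rule compact_imp_closed)
  moreover have "connected ?T"
    by (intro connected_continuous_image continuous_on_torus_proj connected_UNIV
        linear_continuous_on linear_plane_map[unfolded linear_conv_bounded_linear])
  moreover have "torus_subgroup ?T"
    unfolding torus_subgroup_def
  proof (intro conjI)
    show "0 \<in> ?T"
      by (metis plane_map_simps(4) rangeI imageI torus_proj_zero)
    show "\<forall>x\<in>?T. \<forall>y\<in>?T. x + y \<in> ?T"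
      by (auto simp flip: torus_proj_add plane_map_simps)
    show "\<forall>x\<in>?T. - x \<in> ?T"
      by (auto simp flip: torus_proj_minus plane_map_simps)
  qed
  ultimately show ?thesis
    unfolding two_dim_torus_def using F(3) range by blast
qed

text \<open>
  A line that is dense in the 2-torus is carried to a line that is dense in the embedded torus.
\<close>

lemma closure_line_in_plane:
  assumes basis: "integral_plane_basis p q"
    and indep: "\<And>k. k \<in> int_lattice \<Longrightarrow> k \<bullet> y = 0 \<Longrightarrow> k = 0"
  shows "closure (torus_proj ` range (\<lambda>t. t *\<^sub>R plane_map p q y)) = torus_proj ` range (plane_map p q)"
proof
  obtain F where F: "\<And>x. F (torus_proj x) = torus_proj (plane_map p q x)" "continuous_on UNIV F"
    using plane_map_torus_descends[OF basis] by metis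
  let ?L = "torus_proj ` range (\<lambda>t. t *\<^sub>R y)"
  have L: "F ` ?L = torus_proj ` range (\<lambda>t. t *\<^sub>R plane_map p q y)"
    by (simp add: image_image F(1) plane_map_simps)
  have "F ` closure ?L \<subseteq> closure (F ` ?L)"
    using F(2) by (intro image_closure_subset closed_closure closure_subset)
      (auto intro: continuous_on_subset)
  moreover have "closure ?L = range torus_proj"
    using dense_line_in_torus indep by (metis surj_torus_proj)
  ultimately show "torus_proj ` range (plane_map p q) \<subseteq> closure (torus_proj ` range (\<lambda>t. t *\<^sub>R plane_map p q y))"
    unfolding L by (simp add: image_image F(1))
  have "torus_proj ` range (\<lambda>t. t *\<^sub>R plane_map p q y) \<subseteq> torus_proj ` range (plane_map p q)"
    by (auto simp flip: plane_map_simps)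
  then show "closure (torus_proj ` range (\<lambda>t. t *\<^sub>R plane_map p q y)) \<subseteq> torus_proj ` range (plane_map p q)"
    using two_dim_torus_plane[OF basis] by (intro closure_minimal) (auto simp: two_dim_torus_def)
qed

section \<open>Eigenvectors of a partially hyperbolic automorphism\<close>

lemma real_matrix_component: "(real_matrix A *v x) $ i = (\<Sum>j\<in>UNIV. of_int (A $ i $ j) * x $ j)"
  by (simp add: real_matrix_def map_matrix_def matrix_vector_mult_def)

lemma real_matrix_int_lattice: "x \<in> int_lattice \<Longrightarrow> real_matrix A *v x \<in> int_lattice"
  by (auto simp: int_lattice_def real_matrix_component intro!: Ints_sum Ints_mult)

lemma int_lattice_real_matrix: "x \<in> int_lattice \<Longrightarrow> x v* real_matrix A \<in> int_lattice"
  by (auto simp: int_lattice_def vector_matrix_mult_def real_matrix_def map_matrix_def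
      intro!: Ints_sum Ints_mult)

text \<open>
  A sequence of integers that tends to zero is eventually zero. Every arithmetic obstruction to the
  integrality of eigenvectors below is an instance of this.
\<close>

lemma geometric_decay_not_integer:
  fixes l r :: real
  assumes "\<bar>l\<bar> < 1" "l \<noteq> 0" and int: "\<And>n. l ^ n * r \<in> \<int>"
  shows "r = 0"
proof (rule ccontr)
  assume "r \<noteq> 0"
  have "(\<lambda>n. l ^ n * r) \<longlonglongrightarrow> 0"
    using assms by (intro tendsto_mult_left_zero LIMSEQ_power_zero) auto
  then have "\<forall>\<^sub>F n in sequentially. \<bar>l ^ n * r\<bar> < 1"
    by (intro order_tendstoD(2)[OF tendsto_rabs_zero]) auto
  then obtain n where "\<bar>l ^ n * r\<bar> < 1"
    by (auto simp: eventually_sequentially)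
  moreover have "l ^ n * r \<noteq> 0"
    using \<open>r \<noteq> 0\<close> \<open>l \<noteq> 0\<close> by simp
  ultimately show False
    using int[of n] Ints_nonzero_abs_less1 by blast
qed

text \<open>
  A real eigenframe of \<open>A\<close>: \<open>v\<close> is unstable, \<open>w\<close> is stable, and \<open>a\<close>, \<open>b\<close> are the real and the imaginary
  part of an eigenvector for \<open>exp (\<i> \<alpha>)\<close>, so that \<open>A\<close> rotates their plane.
\<close>

locale partially_hyperbolic_frame =
  fixes A :: "int^4^4" and l \<alpha> :: real and v w a b :: "real^4"
  assumes l: "l \<noteq> 0" "\<bar>l\<bar> < 1" and sin: "sin \<alpha> \<noteq> 0"
    and nonzero: "v \<noteq> 0" "w \<noteq> 0" "a \<noteq> 0 \<or> b \<noteq> 0"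
    and eigen: "real_matrix A *v v = inverse l *\<^sub>R v" "real_matrix A *v w = l *\<^sub>R w"
      "real_matrix A *v a = cos \<alpha> *\<^sub>R a - sin \<alpha> *\<^sub>R b" "real_matrix A *v b = sin \<alpha> *\<^sub>R a + cos \<alpha> *\<^sub>R b"
begin

abbreviation M :: "real^4 \<Rightarrow> real^4" where
  "M x \<equiv> real_matrix A *v x"

lemmas M_simps = linear_add[OF matrix_vector_mul_linear[of "real_matrix A"]]
  linear_diff[OF matrix_vector_mul_linear[of "real_matrix A"]]
  linear_scale[OF matrix_vector_mul_linear[of "real_matrix A"]]
  linear_0[OF matrix_vector_mul_linear[of "real_matrix A"]]

definition frame :: "real \<Rightarrow> real \<Rightarrow> real \<Rightarrow> real \<Rightarrow> real^4" where
  "frame r s g h = r *\<^sub>R v + s *\<^sub>R w + g *\<^sub>R a + h *\<^sub>R b"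

text \<open>
  The elliptic factor is the polynomial \<open>(t - exp (\<i> \<alpha>)) (t - exp (- \<i> \<alpha>))\<close>. Evaluated at \<open>A\<close> it becomes an
  operator that annihilates the rotation plane and is invertible on the plane of \<open>v\<close> and \<open>w\<close>; it
  separates the elliptic from the hyperbolic part of a vector.
\<close>

definition elliptic_factor :: "real \<Rightarrow> real" where
  "elliptic_factor t = t\<^sup>2 - 2 * cos \<alpha> * t + 1"

definition elliptic_op :: "real^4 \<Rightarrow> real^4" where
  "elliptic_op x = M (M x) - (2 * cos \<alpha>) *\<^sub>R M x + x"

lemma linear_elliptic_op: "linear elliptic_op"
  by (auto simp: linear_iff elliptic_op_def M_simps algebra_simps)

lemma elliptic_factor_pos: "elliptic_factor t > 0"
proof -
  have "elliptic_factor t = (t - cos \<alpha>)\<^sup>2 + (sin \<alpha>)\<^sup>2"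
    by (simp add: elliptic_factor_def power2_diff cos_squared_eq algebra_simps)
  then show ?thesis
    using sin by (simp add: add_nonneg_pos)
qed

lemma eigenvalues_distinct: "inverse l \<noteq> l"
  using l by (metis abs_mult abs_one abs_square_less_1 less_irrefl power2_eq_square right_inverse)

lemma elliptic_op_eigenvector: "M x = t *\<^sub>R x \<Longrightarrow> elliptic_op x = elliptic_factor t *\<^sub>R x"
  by (simp add: elliptic_op_def elliptic_factor_def M_simps algebra_simps power2_eq_square)

lemma elliptic_op_elliptic: "elliptic_op a = 0" "elliptic_op b = 0"
proof -
  have pythagoras: "cos \<alpha> * (cos \<alpha> * t) + sin \<alpha> * (sin \<alpha> * t) = t" for t
    using sin_cos_squared_add[of \<alpha>] by algebra
  show "elliptic_op a = 0" "elliptic_op b = 0"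
    by (simp_all add: vec_eq_iff elliptic_op_def M_simps eigen algebra_simps, simp_all add: pythagoras)
qed

lemma elliptic_op_frame:
  "elliptic_op (frame r s g h) =
     (r * elliptic_factor (inverse l)) *\<^sub>R v + (s * elliptic_factor l) *\<^sub>R w"
  by (simp add: frame_def linear_add[OF linear_elliptic_op] linear_scale[OF linear_elliptic_op]
      elliptic_op_elliptic elliptic_op_eigenvector[OF eigen(1)] elliptic_op_eigenvector[OF eigen(2)])

lemma hyperbolic_independent:
  assumes "r *\<^sub>R v + s *\<^sub>R w = 0"
  shows "r = 0" "s = 0"
proof -
  have "M (r *\<^sub>R v + s *\<^sub>R w) - l *\<^sub>R (r *\<^sub>R v + s *\<^sub>R w) = (r * (inverse l - l)) *\<^sub>R v"
    by (simp add: M_simps eigen algebra_simps)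
  then show "r = 0"
    using assms nonzero eigenvalues_distinct by (simp add: M_simps)
  with assms show "s = 0"
    using nonzero by simp
qed

lemma elliptic_independent:
  assumes "g *\<^sub>R a + h *\<^sub>R b = 0"
  shows "g = 0" "h = 0"
proof -
  have "M (g *\<^sub>R a + h *\<^sub>R b) - cos \<alpha> *\<^sub>R (g *\<^sub>R a + h *\<^sub>R b) = sin \<alpha> *\<^sub>R (h *\<^sub>R a - g *\<^sub>R b)"
    by (simp add: M_simps eigen algebra_simps)
  then have rotated: "h *\<^sub>R a - g *\<^sub>R b = 0"
    using assms sin by (simp add: M_simps)
  \<comment> \<open>Both \<open>g a + h b\<close> and its quarter turn \<open>h a - g b\<close> vanish, hence so do \<open>(g\<^sup>2 + h\<^sup>2) a\<close> and \<open>(g\<^sup>2 + h\<^sup>2) b\<close>.\<close>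
  have "(g\<^sup>2 + h\<^sup>2) *\<^sub>R a = g *\<^sub>R (g *\<^sub>R a + h *\<^sub>R b) + h *\<^sub>R (h *\<^sub>R a - g *\<^sub>R b)"
    "(g\<^sup>2 + h\<^sup>2) *\<^sub>R b = h *\<^sub>R (g *\<^sub>R a + h *\<^sub>R b) - g *\<^sub>R (h *\<^sub>R a - g *\<^sub>R b)"
    by (simp_all add: algebra_simps power2_eq_square)
  then have "g\<^sup>2 + h\<^sup>2 = 0"
    using nonzero unfolding assms rotated by auto
  then show "g = 0" "h = 0"
    by (simp_all add: sum_power2_eq_zero_iff)
qed

text \<open>
  Applying the elliptic operator to a vanishing combination of the four vectors removes the
  elliptic terms, so independence reduces to the two planes; four independent vectors span.
\<close>

lemma frame_spans: obtains r s g h where "x = frame r s g h"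
proof -
  define P where "P = (\<lambda>x :: real^4. frame (x $ 1) (x $ 2) (x $ 3) (x $ 4))"
  have "linear P"
    by (auto simp: linear_iff P_def frame_def algebra_simps)
  moreover have "x = 0" if "P x = 0" for x
  proof -
    have zero: "frame (x $ 1) (x $ 2) (x $ 3) (x $ 4) = 0"
      using that by (simp add: P_def)
    then have "x $ 1 = 0" "x $ 2 = 0"
      using elliptic_op_frame[of "x $ 1" "x $ 2" "x $ 3" "x $ 4"] elliptic_factor_pos
        hyperbolic_independent linear_0[OF linear_elliptic_op]
      by (metis less_irrefl mult_eq_0_iff)+
    moreover from this have "x $ 3 = 0" "x $ 4 = 0"
      using zero elliptic_independent by (auto simp: frame_def)
    ultimately show ?thesis
      by (simp add: vec_eq_iff forall_4)
  qed
  ultimately have "surj P"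
    by (intro linear_injective_imp_surjective) (simp_all add: linear_injective_0)
  then show thesis
    using that by (metis P_def surjD)
qed

lemma unstable_eigenspace: "{x. M x = inverse l *\<^sub>R x} = range (\<lambda>t. t *\<^sub>R v)"
proof safe
  fix x assume x: "M x = inverse l *\<^sub>R x"
  obtain r s g h where "x = frame r s g h"
    by (rule frame_spans)
  let ?q = "elliptic_factor (inverse l)" and ?s = "s * elliptic_factor l"
  have qx: "?q *\<^sub>R x = (r * ?q) *\<^sub>R v + ?s *\<^sub>R w"
    using elliptic_op_eigenvector[OF x] elliptic_op_frame \<open>x = frame r s g h\<close> by metis
  have "(?s * (l - inverse l)) *\<^sub>R w = M (?q *\<^sub>R x) - inverse l *\<^sub>R (?q *\<^sub>R x)"
    unfolding qx by (simp add: M_simps eigen algebra_simps)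
  also have "\<dots> = 0"
    by (simp add: M_simps x)
  finally have "?s = 0"
    using nonzero eigenvalues_distinct by auto
  then have "?q *\<^sub>R x = ?q *\<^sub>R (r *\<^sub>R v)"
    using qx by (simp add: mult.commute)
  then have "x = r *\<^sub>R v"
    using elliptic_factor_pos[of "inverse l"] by (metis less_irrefl scaleR_cancel_left)
  then show "x \<in> range (\<lambda>t. t *\<^sub>R v)"
    by blast
qed (simp add: M_simps eigen)

section \<open>A resonance makes the rotation trace rational\<close>

text \<open>
  The orbit of \<open>k\<close> under the transpose of \<open>A\<close> stays bounded: its pairing with \<open>v\<close>, the only direction
  that could grow, is zero, its pairing with \<open>w\<close> decays, and its pairings with \<open>a\<close> and \<open>b\<close> rotate. A
  bounded orbit of integer vectors repeats a value, but a nonzero decaying pairing never does.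
\<close>

lemma resonance_stable:
  assumes k: "k \<in> int_lattice" and kv: "k \<bullet> v = 0"
  shows "k \<bullet> w = 0"
proof (rule ccontr)
  assume kw: "k \<bullet> w \<noteq> 0"
  define \<kappa> where "\<kappa> = (\<lambda>n. ((\<lambda>x. x v* real_matrix A) ^^ n) k)"
  have \<kappa>_Suc: "\<kappa> (Suc n) \<bullet> x = \<kappa> n \<bullet> M x" for n x
    by (simp add: \<kappa>_def dot_lmul_matrix)
  have \<kappa>_int: "\<kappa> n \<in> int_lattice" for n
    by (induction n) (auto simp: \<kappa>_def k int_lattice_real_matrix)
  have \<kappa>_v: "\<kappa> n \<bullet> v = 0" for n
    by (induction n) (simp_all add: \<kappa>_Suc eigen kv, simp add: \<kappa>_def kv)
  have \<kappa>_w: "\<kappa> n \<bullet> w = l ^ n * (k \<bullet> w)" for n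
    by (induction n) (simp_all add: \<kappa>_Suc eigen, simp add: \<kappa>_def)
  have \<kappa>_ab: "(\<kappa> n \<bullet> a)\<^sup>2 + (\<kappa> n \<bullet> b)\<^sup>2 = (k \<bullet> a)\<^sup>2 + (k \<bullet> b)\<^sup>2" for n
  proof (induction n)
    case (Suc n)
    have "(\<kappa> (Suc n) \<bullet> a)\<^sup>2 + (\<kappa> (Suc n) \<bullet> b)\<^sup>2 =
        ((sin \<alpha>)\<^sup>2 + (cos \<alpha>)\<^sup>2) * ((\<kappa> n \<bullet> a)\<^sup>2 + (\<kappa> n \<bullet> b)\<^sup>2)"
      unfolding \<kappa>_Suc eigen inner_diff_right inner_add_right inner_scaleR_right by algebra
    then show ?case
      using Suc by simp
  qed (simp add: \<kappa>_def)
  define R where "R = sqrt ((k \<bullet> a)\<^sup>2 + (k \<bullet> b)\<^sup>2)"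
  have bound_ab: "\<bar>\<kappa> n \<bullet> a\<bar> \<le> R" "\<bar>\<kappa> n \<bullet> b\<bar> \<le> R" for n
    using real_sqrt_ge_abs1[of "\<kappa> n \<bullet> a" "\<kappa> n \<bullet> b"] real_sqrt_ge_abs2[of "\<kappa> n \<bullet> b" "\<kappa> n \<bullet> a"]
    by (simp_all add: \<kappa>_ab R_def)
  have bound_w: "\<bar>\<kappa> n \<bullet> w\<bar> \<le> \<bar>k \<bullet> w\<bar>" for n
    using l power_le_one[of "\<bar>l\<bar>" n] by (simp add: \<kappa>_w abs_mult power_abs mult_left_le_one_le)
  have "\<exists>B. \<forall>n. \<bar>\<kappa> n $ i\<bar> \<le> B" for i
  proof -
    obtain r s g h where "axis i 1 = frame r s g h"
      by (rule frame_spans)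
    then have "\<kappa> n $ i = s * (\<kappa> n \<bullet> w) + g * (\<kappa> n \<bullet> a) + h * (\<kappa> n \<bullet> b)" for n
      using inner_axis[of "\<kappa> n" i 1] by (simp add: frame_def inner_add_right \<kappa>_v)
    also have "\<bar>\<dots> n\<bar> \<le> \<bar>s\<bar> * \<bar>k \<bullet> w\<bar> + \<bar>g\<bar> * R + \<bar>h\<bar> * R" for n
      by (intro order.trans[OF abs_triangle_ineq] add_mono)
        (auto simp: abs_mult intro!: mult_left_mono bound_ab bound_w)
    finally show ?thesis
      by blast
  qed
  then obtain B where B: "\<And>i n. \<bar>\<kappa> n $ i\<bar> \<le> B i"
    by metis
  have "range \<kappa> \<subseteq> {x \<in> int_lattice. \<forall>i. \<bar>x $ i\<bar> \<le> Max (range B)}"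
    using \<kappa>_int B by (auto intro!: order.trans[OF B Max_ge])
  then have "finite (range \<kappa>)"
    using finite_bounded_int_lattice by (rule finite_subset)
  then obtain m n where "m < n" "\<kappa> m = \<kappa> n"
    by (metis finite_imageD infinite_UNIV_nat injI linorder_neqE_nat)
  then have "\<bar>l\<bar> ^ m = \<bar>l\<bar> ^ n"
    using \<kappa>_w[of m] \<kappa>_w[of n] kw by (simp flip: power_abs)
  moreover have "\<bar>l\<bar> ^ n < \<bar>l\<bar> ^ m"
    using l \<open>m < n\<close> by (intro power_strict_decreasing) auto
  ultimately show False
    by simp
qed

text \<open>
  By the preceding lemma \<open>k\<close> is orthogonal to the whole hyperbolic plane, which is the image of the
  elliptic operator. Hence the transposed operator annihilates \<open>k\<close>, and this linear relation between
  three integer vectors determines its coefficient \<open>2 cos \<alpha>\<close> as a quotient of integers.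
\<close>

lemma resonance_rational_trace:
  assumes k: "k \<in> int_lattice" "k \<noteq> 0" and kv: "k \<bullet> v = 0"
  shows "2 * cos \<alpha> \<in> \<rat>"
proof -
  define k' k'' where "k' = k v* real_matrix A" and "k'' = k' v* real_matrix A"
  have int: "k' \<in> int_lattice" "k'' \<in> int_lattice"
    unfolding k''_def k'_def by (intro int_lattice_real_matrix k(1))+
  have "(k'' + k) \<bullet> x = ((2 * cos \<alpha>) *\<^sub>R k') \<bullet> x" for x
  proof -
    obtain r s g h where "x = frame r s g h"
      by (rule frame_spans)
    then have "k \<bullet> elliptic_op x = 0"
      by (simp add: elliptic_op_frame inner_add_right kv resonance_stable[OF k(1) kv])
    moreover have "k'' \<bullet> x = k \<bullet> M (M x)" "k' \<bullet> x = k \<bullet> M x"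
      by (simp_all add: k'_def k''_def dot_lmul_matrix)
    ultimately show ?thesis
      by (simp add: elliptic_op_def inner_add_left inner_add_right inner_diff_right)
  qed
  then have rel: "k'' + k = (2 * cos \<alpha>) *\<^sub>R k'"
    using vector_eq_rdot by blast
  have "k' \<noteq> 0"
    using rel k(2) by (auto simp: k''_def)
  then obtain i where "k' $ i \<noteq> 0"
    by (auto simp: vec_eq_iff)
  then have "2 * cos \<alpha> = (k'' $ i + k $ i) / k' $ i"
    using arg_cong[OF rel, of "\<lambda>x. x $ i"] by (simp add: field_simps)
  moreover have "k'' $ i \<in> \<rat>" "k $ i \<in> \<rat>" "k' $ i \<in> \<rat>"
    using int k(1) Ints_subset_Rats by (auto dest: int_latticeD)
  ultimately show ?thesis
    by simp
qed

section \<open>The integral hyperbolic plane\<close>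

text \<open>
  When \<open>2 cos \<alpha>\<close> is rational, a nonzero multiple of the elliptic operator is an integer matrix, so
  it sends the standard basis to integer points of the hyperbolic plane. These points cannot all
  lie on the unstable line, because their span contains the image of \<open>w\<close>. A nonzero stable
  coordinate keeps the decaying areas along the orbit of the point different from zero.
\<close>

lemma integral_hyperbolic_point:
  assumes "2 * cos \<alpha> \<in> \<rat>"
  obtains r s where "r *\<^sub>R v + s *\<^sub>R w \<in> int_lattice" "s \<noteq> 0"
proof (rule ccontr)
  assume no_point: "\<not> thesis"
  obtain m n :: int where n: "n \<noteq> 0" and c: "2 * cos \<alpha> = of_int m / of_int n"
    using assms by (metis Rats_cases' less_irrefl)
  have nc: "of_int n * (2 * cos \<alpha>) = of_int m"
    using n by (simp add: c)
  have stays: "elliptic_op (axis i 1) \<in> span {v}" for i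
  proof -
    obtain r s g h where ax: "axis i 1 = frame r s g h"
      by (rule frame_spans)
    let ?r = "r * elliptic_factor (inverse l)" and ?s = "s * elliptic_factor l"
    have "of_int n *\<^sub>R elliptic_op (axis i 1) =
        of_int n *\<^sub>R M (M (axis i 1)) - of_int m *\<^sub>R M (axis i 1) + of_int n *\<^sub>R axis i 1"
      by (simp only: elliptic_op_def scaleR_add_right scaleR_diff_right scaleR_scaleR nc)
    also have "\<dots> \<in> int_lattice"
      by (intro int_lattice_add int_lattice_diff int_lattice_scaleR real_matrix_int_lattice
          axis_in_int_lattice) auto
    finally have "(of_int n * ?r) *\<^sub>R v + (of_int n * ?s) *\<^sub>R w \<in> int_lattice"
      by (simp add: ax elliptic_op_frame scaleR_add_right)
    then have "of_int n * ?s = 0"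
      using no_point that by blast
    then have "?s = 0"
      using n by simp
    then have "elliptic_op (axis i 1) = ?r *\<^sub>R v"
      by (simp only: ax elliptic_op_frame) simp
    then show ?thesis
      by (simp add: span_base span_scale)
  qed
  have "elliptic_op w = elliptic_op (\<Sum>i\<in>UNIV. w $ i *\<^sub>R axis i 1)"
    using basis_expansion[of w] by (simp add: scalar_mult_eq_scaleR)
  also have "\<dots> = (\<Sum>i\<in>UNIV. w $ i *\<^sub>R elliptic_op (axis i 1))"
    by (simp add: linear_sum[OF linear_elliptic_op] linear_scale[OF linear_elliptic_op])
  also have "\<dots> \<in> span {v}"
    by (intro span_sum span_scale stays)
  finally obtain t where "elliptic_factor l *\<^sub>R w = t *\<^sub>R v"
    by (auto simp: elliptic_op_eigenvector[OF eigen(2)] span_singleton)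
  then have "(- t) *\<^sub>R v + elliptic_factor l *\<^sub>R w = 0"
    by simp
  then have "elliptic_factor l = 0"
    by (rule hyperbolic_independent)
  then show False
    using elliptic_factor_pos[of l] by simp
qed

context
  fixes r s assumes point: "r *\<^sub>R v + s *\<^sub>R w \<in> int_lattice" and s: "s \<noteq> 0"
begin

lemma point_orbit: "(r * inverse l ^ n) *\<^sub>R v + (s * l ^ n) *\<^sub>R w \<in> int_lattice"
proof (induction n)
  case (Suc n)
  have "M ((r * inverse l ^ n) *\<^sub>R v + (s * l ^ n) *\<^sub>R w) =
      (r * inverse l ^ Suc n) *\<^sub>R v + (s * l ^ Suc n) *\<^sub>R w"
    by (simp add: M_simps eigen mult_ac)
  with real_matrix_int_lattice[OF Suc] show ?case
    by metis
qed (simp add: point)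

text \<open>
  An integer point on the stable line would have a decaying orbit of nonzero integer vectors.
\<close>

lemma unstable_coordinate_nonzero: "r \<noteq> 0"
proof
  assume "r = 0"
  obtain i where "w $ i \<noteq> 0"
    using nonzero by (auto simp: vec_eq_iff)
  have "l ^ n * (s * w $ i) \<in> \<int>" for n
    using int_latticeD[OF point_orbit[of n], of i] \<open>r = 0\<close> by (simp add: mult_ac)
  then have "s * w $ i = 0"
    using l by (intro geometric_decay_not_integer)
  with s \<open>w $ i \<noteq> 0\<close> show False
    by simp
qed

lemma hyperbolic_minor: obtains i j where "minor2 i j v w \<noteq> 0"
proof (rule exists_nonzero_minor2)
  show "w \<noteq> \<rho> *\<^sub>R v" for \<rho>
    using hyperbolic_independent(2)[of "- \<rho>" 1] by auto
qed (use nonzero in auto)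

text \<open>
  The area spanned by an integer vector \<open>\<rho> v\<close> and the \<open>n\<close>-th image of the integer point sees only the
  stable coordinate of that image, and so is an integer proportional to \<open>l ^ n\<close>.
\<close>

lemma unstable_not_integral:
  assumes "\<rho> *\<^sub>R v \<in> int_lattice"
  shows "\<rho> = 0"
proof -
  obtain i j where minor: "minor2 i j v w \<noteq> 0"
    by (rule hyperbolic_minor)
  have "l ^ n * (\<rho> * s * minor2 i j v w) \<in> \<int>" for n
    using minor2_in_Ints[OF assms point_orbit[of n], of i j]
      minor2_combination[of i j \<rho> v 0 w "r * inverse l ^ n" "s * l ^ n"] by (simp add: mult_ac)
  then have "\<rho> * s * minor2 i j v w = 0"
    using l by (intro geometric_decay_not_integer)
  then show ?thesis
    using s minor by simp
qed

text \<open>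
  The integer point and its image under \<open>A\<close> are independent, so the hyperbolic plane is rational and
  covers a 2-torus. The unstable line has irrational slope in it, since it contains no
  nonzero integer vector, and is therefore dense in that torus.
\<close>

lemma closure_unstable_torus:
  "two_dim_torus (closure (torus_proj ` range (\<lambda>t. t *\<^sub>R v)))"
proof -
  let ?z = "r *\<^sub>R v + s *\<^sub>R w"
  have Mz: "M ?z = (r * inverse l) *\<^sub>R v + (s * l) *\<^sub>R w"
    by (simp add: M_simps eigen)
  obtain i j where "minor2 i j v w \<noteq> 0"
    by (rule hyperbolic_minor)
  moreover have "r * (s * l) - s * (r * inverse l) = r * s * (l - inverse l)"
    by (simp add: algebra_simps)
  ultimately have "minor2 i j ?z (M ?z) \<noteq> 0"
    unfolding Mz minor2_combination using s unstable_coordinate_nonzero eigenvalues_distinct by simp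
  then obtain p q where basis: "integral_plane_basis p q"
      and in_plane: "?z \<in> range (plane_map p q)" "M ?z \<in> range (plane_map p q)"
    using exists_integral_plane_basis[OF point real_matrix_int_lattice[OF point]] by metis
  have "v = (1 / (r * (inverse l - l))) *\<^sub>R (M ?z - l *\<^sub>R ?z)"
  proof -
    have "M ?z - l *\<^sub>R ?z = (r * (inverse l - l)) *\<^sub>R v"
      unfolding Mz by (simp add: algebra_simps)
    then show ?thesis
      using unstable_coordinate_nonzero eigenvalues_distinct by simp
  qed
  also have "\<dots> \<in> range (plane_map p q)"
    using in_plane linear_subspace_image[OF linear_plane_map subspace_UNIV]
    by (intro subspace_scale subspace_diff) auto
  finally obtain y where y: "v = plane_map p q y"
    by blast
  have "k = 0" if k: "k \<in> int_lattice" "k \<bullet> y = 0" for k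
  proof -
    \<comment> \<open>The quarter turn of an integer vector orthogonal to \<open>y\<close> is parallel to \<open>y\<close>, so its image lies on the unstable line.\<close>
    define k' :: "real^2" where "k' = vector [k $ 2, - k $ 1]"
    have "y \<noteq> 0"
      using nonzero(1) by (auto simp: y plane_map_simps)
    have orth: "k $ 1 * y $ 1 + k $ 2 * y $ 2 = 0"
      using k(2) by (simp add: inner_vec_def sum_2)
    obtain \<rho> where \<rho>: "k' = \<rho> *\<^sub>R y"
    proof (cases "y $ 1 = 0")
      case True
      then have "y $ 2 \<noteq> 0" "k $ 2 = 0"
        using \<open>y \<noteq> 0\<close> orth by (auto simp: vec_eq_iff forall_2)
      then have "k' = (- k $ 1 / y $ 2) *\<^sub>R y"
        using True by (simp add: k'_def vec_eq_iff forall_2)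
      then show thesis
        by (rule that)
    next
      case False
      then have "k' = (k $ 2 / y $ 1) *\<^sub>R y"
        using orth by (simp add: k'_def vec_eq_iff forall_2 field_simps)
      then show thesis
        by (rule that)
    qed
    have "k' \<in> int_lattice"
      using k(1) by (simp add: k'_def int_lattice_2_iff)
    then have "\<rho> *\<^sub>R v \<in> int_lattice"
      using basis by (simp add: integral_plane_basis_def \<rho> y flip: plane_map_simps)
    then have "k' = 0"
      using unstable_not_integral \<rho> by simp
    then show "k = 0"
      by (simp add: k'_def vec_eq_iff forall_2)
  qed
  then show ?thesis
    unfolding y using closure_line_in_plane[OF basis] two_dim_torus_plane[OF basis] by simp
qed

end

lemma closure_unstable_line:
  "two_dim_torus (closure (torus_proj ` range (\<lambda>t. t *\<^sub>R v))) \<or>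
   closure (torus_proj ` range (\<lambda>t. t *\<^sub>R v)) = UNIV"
proof (cases "\<exists>k \<in> int_lattice. k \<noteq> 0 \<and> k \<bullet> v = 0")
  case True
  then have "2 * cos \<alpha> \<in> \<rat>"
    using resonance_rational_trace by blast
  then obtain r s where "r *\<^sub>R v + s *\<^sub>R w \<in> int_lattice" "s \<noteq> 0"
    by (rule integral_hyperbolic_point)
  then show ?thesis
    using closure_unstable_torus by blast
next
  case False
  then show ?thesis
    using dense_line_in_torus[of v] by blast
qed

end

section \<open>The closure of the unstable leaf\<close>

lemma complex_matrix_parts:
  "(\<chi> i. Re ((complex_matrix A *v z) $ i)) = real_matrix A *v (\<chi> i. Re (z $ i))"
  "(\<chi> i. Im ((complex_matrix A *v z) $ i)) = real_matrix A *v (\<chi> i. Im (z $ i))"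
  by (simp_all add: vec_eq_iff complex_matrix_def real_matrix_def map_matrix_def
      matrix_vector_mult_def)

lemma real_eigenvector:
  assumes "complex_of_real t \<in> eigenvalues A"
  obtains x where "x \<noteq> 0" "real_matrix A *v x = t *\<^sub>R x"
proof -
  obtain z where z: "z \<noteq> 0" "complex_matrix A *v z = complex_of_real t *s z"
    using assms unfolding eigenvalues_def by blast
  define x y where "x = (\<chi> i. Re (z $ i))" and "y = (\<chi> i. Im (z $ i))"
  have "real_matrix A *v x = t *\<^sub>R x" "real_matrix A *v y = t *\<^sub>R y"
    unfolding x_def y_def complex_matrix_parts[symmetric] z(2) by (simp_all add: vec_eq_iff)
  moreover have "x \<noteq> 0 \<or> y \<noteq> 0"
    using z(1) by (auto simp: x_def y_def vec_eq_iff complex_eq_iff)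
  ultimately show thesis
    using that by blast
qed

text \<open>
  These are the real and the imaginary part of the equation \<open>A (a + \<i> b) = exp (\<i> \<alpha>) (a + \<i> b)\<close>.
\<close>

lemma rotation_eigenvectors:
  assumes "cis \<alpha> \<in> eigenvalues A"
  obtains a b where "a \<noteq> 0 \<or> b \<noteq> 0"
    "real_matrix A *v a = cos \<alpha> *\<^sub>R a - sin \<alpha> *\<^sub>R b"
    "real_matrix A *v b = sin \<alpha> *\<^sub>R a + cos \<alpha> *\<^sub>R b"
proof -
  obtain z where z: "z \<noteq> 0" "complex_matrix A *v z = cis \<alpha> *s z"
    using assms unfolding eigenvalues_def by blast
  define x y where "x = (\<chi> i. Re (z $ i))" and "y = (\<chi> i. Im (z $ i))"
  have "real_matrix A *v x = cos \<alpha> *\<^sub>R x - sin \<alpha> *\<^sub>R y"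
      "real_matrix A *v y = sin \<alpha> *\<^sub>R x + cos \<alpha> *\<^sub>R y"
    unfolding x_def y_def complex_matrix_parts[symmetric] z(2) by (simp_all add: vec_eq_iff)
  moreover have "x \<noteq> 0 \<or> y \<noteq> 0"
    using z(1) by (auto simp: x_def y_def vec_eq_iff complex_eq_iff)
  ultimately show thesis
    using that by blast
qed

theorem proposition2:
  fixes A :: "int^4^4"
  assumes "unimodular A" and "symplectic A" and "partially_hyperbolic A"
  shows "two_dim_torus (closure (unstable_leaf A)) \<or> closure (unstable_leaf A) = UNIV"
proof -
  obtain l \<alpha> where l: "0 < \<bar>l\<bar>" "\<bar>l\<bar> < 1" and \<alpha>: "cis \<alpha> \<notin> \<real>"
    and eig: "eigenvalues A = {of_real l, of_real (inverse l), cis \<alpha>, cis (- \<alpha>)}"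
    using assms(3) unfolding partially_hyperbolic_def by metis
  obtain v where v: "v \<noteq> 0" "real_matrix A *v v = inverse l *\<^sub>R v"
    using real_eigenvector[of "inverse l" A] eig by blast
  obtain w where w: "w \<noteq> 0" "real_matrix A *v w = l *\<^sub>R w"
    using real_eigenvector[of l A] eig by blast
  obtain a b where ab: "a \<noteq> 0 \<or> b \<noteq> 0"
      "real_matrix A *v a = cos \<alpha> *\<^sub>R a - sin \<alpha> *\<^sub>R b"
      "real_matrix A *v b = sin \<alpha> *\<^sub>R a + cos \<alpha> *\<^sub>R b"
    using rotation_eigenvectors[of \<alpha> A] eig by blast
  have "sin \<alpha> \<noteq> 0"
    using \<alpha> by (auto simp: complex_is_Real_iff)
  then interpret partially_hyperbolic_frame A l \<alpha> v w a b
    using l v w ab by unfold_locales auto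
  have "unstable_eigenvalue A = inverse l"
    unfolding unstable_eigenvalue_def
  proof (rule the_equality)
    show "1 < \<bar>inverse l\<bar> \<and> complex_of_real (inverse l) \<in> eigenvalues A"
      using l by (simp add: eig one_less_inverse)
  next
    fix \<mu> assume \<mu>: "1 < \<bar>\<mu>\<bar> \<and> complex_of_real \<mu> \<in> eigenvalues A"
    then have "norm (complex_of_real \<mu>) > 1"
      by simp
    then have "complex_of_real \<mu> \<noteq> cis \<alpha>" "complex_of_real \<mu> \<noteq> cis (- \<alpha>)" "complex_of_real \<mu> \<noteq> of_real l"
      using l(2) by (metis norm_cis less_irrefl, metis norm_cis less_irrefl, force)
    with \<mu> show "\<mu> = inverse l"
      unfolding eig using of_real_eq_iff by blast
  qed
  then have "unstable_leaf A = torus_proj ` range (\<lambda>t. t *\<^sub>R v)"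
    by (simp add: unstable_leaf_def unstable_line_def unstable_eigenspace)
  then show ?thesis
    using closure_unstable_line by simp
qed

end
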